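(* Let $G$ be a finite simple connected graph with $n$ vertices, $m$ edges and matching number $\mu(G)$, and let $\alpha$ be a magnetic potential on $G$. (i) If $n>2\mu(G)$, then $\lambda_{\mu(G)+n-m}(\Delta_\alpha^G)<2<\lambda_{n-\mu(G)+1}(\Delta_\alpha^G)$. (ii) If $n=2\mu(G)$, then $\lambda_{\frac{3n}{2}-m-1}(\Delta_\alpha^G)<2<\lambda_{\frac n2+2}(\Delta_\alpha^G)$. Here each individual inequality involving an eigenvalue $\lambda_j$ is asserted whenever its index satisfies $1\le j\le n$.
   Context: For a finite simple graph $G=(V,E)$ let $A$ be its set of arcs: each edge gives two oppositely oriented arcs $e,\bar e$; an arc $e$ has initial vertex $\partial_-e$ and terminal vertex $\partial_+e$; $A_v=\{e\in A : \partial_-e=v\}$ and $\deg(v)=|A_v|$. A magnetic potential on $G$ is a map $\alpha\colon A\to\mathbb{R}/2\pi\mathbb{Z}$ with $\alpha_{\bar e}=-\alpha_e$ for all $e\in A$. The discrete magnetic Laplacian is the operator $\Delta_\alpha^G$ on $\mathbb{C}^{V}$ (with its standard inner product) given by $(\Delta_\alpha^G\varphi)(v)=\deg(v)\varphi(v)-\sum_{e\in A_v}\mathrm{e}^{\mathrm{i}\alpha_e}\varphi(\partial_+e)$; it is self-adjoint and positive semidefinite. Its eigenvalues are written in ascending order, repeated according to multiplicity: $\lambda_1(\Delta_\alpha^G)\le\dots\le\lambda_n(\Delta_\alpha^G)$, $n=|V|$. The matching number $\mu(G)$ is the maximum number of edges of $G$ no two of which share a vertex. *)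

theory Defs
  imports "HOL-Analysis.Analysis" "HOL-Library.Real_Mod" "Graph_Theory.Graph_Theory"
begin

text \<open>
  A finite simple graph is a \<^locale>\<open>pair_graph\<close>: a finite, loop-free, symmetric digraph whose arcs
  are ordered pairs of vertices. The arc opposite to \<open>e\<close> is \<open>prod.swap e\<close>, its initial vertex is
  \<open>fst e\<close> and its terminal vertex is \<open>snd e\<close>. The number of edges counts unordered pairs, so it is
  half the number of arcs.
\<close>

definition uedges :: "'v pair_pre_digraph \<Rightarrow> 'v set set" where
  "uedges G = (\<lambda>(u, v). {u, v}) ` parcs G"

definition matching :: "'v pair_pre_digraph \<Rightarrow> 'v set set \<Rightarrow> bool" where
  "matching G M \<longleftrightarrow> M \<subseteq> uedges G \<and> pairwise disjnt M"

definition matching_number :: "'v pair_pre_digraph \<Rightarrow> nat" where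
  "matching_number G = Max {card M | M. matching G M}"

text \<open>
  A map from the arcs to \<open>\<real>/2\<pi>\<int>\<close> is given by real representatives: the antisymmetry condition is
  required only modulo \<open>2\<pi>\<close>, and the Laplacian depends on \<open>\<alpha>\<close> only through \<open>cis (\<alpha> e) = exp (\<i> \<alpha> e)\<close>.
\<close>

definition magnetic_potential :: "'v pair_pre_digraph \<Rightarrow> ('v \<times> 'v \<Rightarrow> real) \<Rightarrow> bool" where
  "magnetic_potential G \<alpha> \<longleftrightarrow> (\<forall>e\<in>parcs G. [\<alpha> (prod.swap e) = - \<alpha> e] (rmod (2 * pi)))"

text \<open>
  Functions on the vertices are vectors indexed by the vertex type, so the operator below is the
  Laplacian of \<open>G\<close> when \<open>pverts G = UNIV\<close>.
\<close>

definition magnetic_laplacian ::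
    "'v::finite pair_pre_digraph \<Rightarrow> ('v \<times> 'v \<Rightarrow> real) \<Rightarrow> complex ^ 'v \<Rightarrow> complex ^ 'v" where
  "magnetic_laplacian G \<alpha> \<phi> =
     (\<chi> v. of_nat (out_degree (with_proj G) v) * \<phi> $ v
           - (\<Sum>e\<in>out_arcs (with_proj G) v. cis (\<alpha> e) * \<phi> $ snd e))"

text \<open>
  Eigenvalues of a self-adjoint operator: all of them are real, and the multiplicity of \<open>x\<close> is the
  complex dimension of its eigenspace (\<open>0\<close> if \<open>x\<close> is not an eigenvalue).
\<close>

definition eig_mult :: "(complex ^ 'v \<Rightarrow> complex ^ 'v::finite) \<Rightarrow> real \<Rightarrow> nat" where
  "eig_mult T x = vec.dim {\<phi>. T \<phi> = complex_of_real x *s \<phi>}"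

definition eigenvalue_list :: "(complex ^ 'v \<Rightarrow> complex ^ 'v::finite) \<Rightarrow> real list" where
  "eigenvalue_list T =
     sorted_list_of_multiset (\<Sum>x | eig_mult T x > 0. replicate_mset (eig_mult T x) x)"

text \<open>
  The index is an integer counted from \<open>1\<close>, as index expressions such as \<open>\<mu> + n - m\<close> may be negative;
  the value is meaningful only for \<open>1 \<le> j \<le> n\<close>.
\<close>

definition eigval :: "(complex ^ 'v \<Rightarrow> complex ^ 'v::finite) \<Rightarrow> int \<Rightarrow> real" where
  "eigval T j = eigenvalue_list T ! nat (j - 1)"

end

theory Submission
  imports Defs
begin

text \<open>
  Let \<open>d\<close> be the magnetic coboundary, so that the Laplacian is \<open>L = B d\<close> with \<open>B\<close> the adjoint of \<open>d\<close>
  on functions counted once per edge, and fix a maximum matching \<open>M\<close>.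

  Consider vectors \<open>g\<close> on the vertices that vanish outside \<open>\<Union>M\<close> and satisfy \<open>(d g) e = 2 g (fst e)\<close> on matched
  arcs. For these, \<open>\<langle>L g, g\<rangle> = 2 |g|\<^sup>2 + |h|\<^sup>2\<close>, where \<open>h\<close> is the part of \<open>d g\<close> off the matching. If \<open>h = 0\<close>,
  then \<open>|g|\<close> is constant because \<open>G\<close> is connected, so \<open>g = 0\<close> as soon as \<open>g\<close> vanishes at one vertex. This
  is automatic when some vertex is unmatched; for a perfect matching it costs one more linear
  condition. The space of such \<open>g\<close> bounds the number of eigenvalues greater than \<open>2\<close>.

  For the eigenvalues less than \<open>2\<close>, consider \<open>\<phi>\<close> with \<open>d \<phi> = c - r h\<close>, where \<open>c\<close> lives on the matching,
  \<open>g = B c\<close> is of the above kind with \<open>h\<close> as before, and \<open>r > 0\<close> is small. The restriction of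
  \<open>|B \<psi>|\<^sup>2 - 2 |\<psi>|\<^sup>2\<close> to matched \<open>\<psi>\<close> is \<open>0\<close>, and the first-order term of the perturbation makes it
  negative, hence \<open>|L \<phi>|\<^sup>2 < 2 \<langle>L \<phi>, \<phi>\<rangle>\<close> unless \<open>L \<phi> = 0\<close>. The condition on \<open>\<phi>\<close> is one linear
  equation per unmatched edge.
\<close>

section \<open>Dimension counts\<close>

text \<open>Bases of the two subspaces stay independent when joined: a vanishing combination puts
  its \<open>A\<close>-part into \<open>A \<inter> B\<close>, so both parts are zero.\<close>

lemma dim_sum_disjoint_subspaces:
  fixes A B :: "('a::field ^ 'n) set"
  assumes A: "vec.subspace A" and B: "vec.subspace B" and AB: "A \<inter> B = {0}"
  shows "vec.dim {x + y |x y. x \<in> A \<and> y \<in> B} = vec.dim A + vec.dim B"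
proof -
  obtain P where P: "P \<subseteq> A" "vec.independent P" "A \<subseteq> vec.span P" "card P = vec.dim A"
    using vec.basis_exists by metis
  obtain Q where Q: "Q \<subseteq> B" "vec.independent Q" "B \<subseteq> vec.span Q" "card Q = vec.dim B"
    using vec.basis_exists by metis
  have fin: "finite P" "finite Q" using P(2) Q(2) by (simp_all add: vec.finiteI_independent)
  have sP: "vec.span P = A" by (rule vec.span_subspace[OF P(1) P(3) A])
  have sQ: "vec.span Q = B" by (rule vec.span_subspace[OF Q(1) Q(3) B])
  have "0 \<notin> P" using P(2) by (metis vec.dependent_zero)
  moreover have "P \<inter> Q \<subseteq> {0}" unfolding AB[symmetric] using P(1) Q(1) by (rule Int_mono)
  ultimately have dis: "P \<inter> Q = {}" by (metis IntE equals0I singletonD subsetD)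
  have ind: "vec.independent (P \<union> Q)"
  proof (rule vec.independent_if_scalars_zero)
    show "finite (P \<union> Q)" using fin by simp
    fix f x assume z: "(\<Sum>x\<in>P \<union> Q. f x *s x) = 0" and x: "x \<in> P \<union> Q"
    have z': "(\<Sum>x\<in>P. f x *s x) + (\<Sum>x\<in>Q. f x *s x) = 0"
      using z by (simp add: sum.union_disjoint fin dis)
    have a: "(\<Sum>x\<in>P. f x *s x) \<in> A"
      unfolding sP[symmetric] by (intro vec.span_sum vec.span_scale vec.span_base)
    have b: "(\<Sum>x\<in>Q. f x *s x) \<in> B"
      unfolding sQ[symmetric] by (intro vec.span_sum vec.span_scale vec.span_base)
    have "(\<Sum>x\<in>P. f x *s x) = - (\<Sum>x\<in>Q. f x *s x)" using z' by (simp add: eq_neg_iff_add_eq_0)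
    then have "(\<Sum>x\<in>P. f x *s x) \<in> A \<inter> B" using a b B vec.subspace_neg by auto
    then have p0: "(\<Sum>x\<in>P. f x *s x) = 0" using AB by blast
    then have q0: "(\<Sum>x\<in>Q. f x *s x) = 0" using z' by simp
    show "f x = 0"
      using x vec.independentD[OF P(2) fin(1) order_refl p0] vec.independentD[OF Q(2) fin(2) order_refl q0]
      by blast
  qed
  have "vec.span (P \<union> Q) = {x + y |x y. x \<in> A \<and> y \<in> B}"
    by (simp add: vec.span_Un sP sQ)
  then have "vec.dim {x + y |x y. x \<in> A \<and> y \<in> B} = card (P \<union> Q)"
    using vec.dim_span_eq_card_independent[OF ind] by simp
  then show ?thesis using P Q fin dis by (simp add: card_Un_disjoint)
qed

lemma dim_disjoint_subspaces_le:
  fixes A B :: "('a::field ^ 'n) set"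
  assumes "vec.subspace A" "vec.subspace B" "A \<inter> B = {0}"
  shows "vec.dim A + vec.dim B \<le> CARD('n)"
  unfolding dim_sum_disjoint_subspaces[OF assms, symmetric] by (rule dim_subset_UNIV_cart_gen)

text \<open>Each condition costs at most one dimension: if some earlier solution \<open>v\<close>
  has \<open>l i v \<noteq> 0\<close>, subtracting a multiple of \<open>v\<close> moves any earlier
  solution into the smaller space.\<close>

lemma dim_solution_space_ge:
  fixes l :: "'i \<Rightarrow> 'a::field ^ 'n \<Rightarrow> 'a"
  assumes "finite I"
    and "\<And>i x y. i \<in> I \<Longrightarrow> l i (x + y) = l i x + l i y"
    and "\<And>i c x. i \<in> I \<Longrightarrow> l i (c *s x) = c * l i x"
  shows "vec.subspace {x. \<forall>i\<in>I. l i x = 0} \<and> CARD('n) \<le> vec.dim {x. \<forall>i\<in>I. l i x = 0} + card I"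
  using assms
proof (induction I)
  case empty
  show ?case using vec_dim_card[where 'n='n and 'a='a] by (simp del: vec.dim_UNIV)
next
  case (insert i I)
  let ?S = "{x. \<forall>i\<in>I. l i x = 0}" and ?R = "{x. \<forall>j\<in>insert i I. l j x = 0}"
  have IH: "vec.subspace ?S" "CARD('n) \<le> vec.dim ?S + card I"
    using insert.IH insert.prems by blast+
  have z: "l j 0 = 0" if "j \<in> insert i I" for j
    using insert.prems(2)[OF that, of 0 0] by simp
  have sub: "vec.subspace ?R"
    by (rule vec.subspaceI) (simp_all add: z insert.prems)
  have "vec.dim ?S \<le> vec.dim ?R + 1"
  proof (cases "?S \<subseteq> ?R")
    case True
    from vec.dim_subset[OF this] show ?thesis by simp
  next
    case False
    then obtain v where v: "v \<in> ?S" "l i v \<noteq> 0" by auto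
    have "?S \<subseteq> vec.span (insert v ?R)"
    proof
      fix x assume x: "x \<in> ?S"
      let ?c = "l i x / l i v"
      have m: "l j (x - ?c *s v) = l j x - ?c * l j v" if "j \<in> insert i I" for j
        using insert.prems(1)[OF that, of "x - ?c *s v" "?c *s v"] insert.prems(2)[OF that] by simp
      have "x - ?c *s v \<in> ?R"
        using x v m by auto
      then have "x - ?c *s v \<in> vec.span ?R" by (rule vec.span_base)
      then show "x \<in> vec.span (insert v ?R)"
        unfolding vec.span_insert by blast
    qed
    from vec.dim_mono[OF this] vec.dim_insert[of v ?R] show ?thesis
      by (simp only: split: if_splits)
  qed
  then have "CARD('n) \<le> vec.dim ?R + card (insert i I)"
    using IH(2) by (simp only: card_insert_disjoint[OF insert.hyps])
  with sub show ?case by blast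
qed

section \<open>Self-adjoint operators\<close>

lemma inner_complex_mult_left: "inner (c * a) b = inner a (cnj c * b)" for a b c :: complex
  by (simp add: inner_complex_def algebra_simps)

text \<open>Dimensions refer to complex scalars, norms and orthogonality to the real inner product;
  this translates between the two actions.\<close>

lemma complex_of_real_scale: "complex_of_real r *s x = r *\<^sub>R x" for x :: "complex ^ 'n"
  by (simp add: vec_eq_iff) (simp add: scaleR_conv_of_real)

text \<open>Maximise the Rayleigh quotient over the unit sphere of \<open>S\<close>.\<close>
lemma self_adjoint_eigenvector_exists:
  fixes T :: "'a::euclidean_space \<Rightarrow> 'a"
  assumes lin: "linear T" and adj: "\<And>x y. inner (T x) y = inner x (T y)"
    and S: "subspace S" and inv: "\<And>x. x \<in> S \<Longrightarrow> T x \<in> S" and ne: "S \<noteq> {0}"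
  obtains x r where "x \<in> S" "x \<noteq> 0" "T x = r *\<^sub>R x"
proof -
  let ?K = "S \<inter> sphere 0 1"
  have "compact ?K" using closed_subspace[OF S] by (metis closed_Int_compact compact_sphere)
  moreover obtain s where s: "s \<in> S" "s \<noteq> 0" using ne S subspace_0 by blast
  then have "s /\<^sub>R norm s \<in> ?K" using S by (simp add: subspace_scale)
  then have "?K \<noteq> {}" by blast
  moreover have "continuous_on ?K (\<lambda>x. inner (T x) x)"
    using lin by (intro continuous_intros linear_continuous_on) (simp add: linear_conv_bounded_linear)
  ultimately obtain x where x: "x \<in> ?K" and mx: "\<And>y. y \<in> ?K \<Longrightarrow> inner (T y) y \<le> inner (T x) x"
    using continuous_attains_sup[of ?K "\<lambda>x. inner (T x) x"] by blast
  define r where "r = inner (T x) x"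
  have xx: "inner x x = 1" using x by (simp add: dot_square_norm)
  have le: "inner (T y) y \<le> r * inner y y" if "y \<in> S" for y
  proof (cases "y = 0")
    case False
    then have "y /\<^sub>R norm y \<in> ?K" using S that by (simp add: subspace_scale)
    then have "inner (T (y /\<^sub>R norm y)) (y /\<^sub>R norm y) \<le> r" using mx r_def by blast
    then have "inner (T y) y / (norm y)\<^sup>2 \<le> r"
      by (simp add: linear_cmul[OF lin] power2_eq_square divide_inverse mult_ac)
    then show ?thesis using False by (simp add: dot_square_norm divide_le_eq)
  qed (simp add: linear_0[OF lin])
  define z where "z = T x - r *\<^sub>R x"
  have zS: "z \<in> S" unfolding z_def using x inv S by (simp add: subspace_diff subspace_scale)
  define k where "k = r * inner z z - inner (T z) z"
  \<comment> \<open>Maximality is tested on \<open>x + t *\<^sub>R z\<close>, where \<open>z\<close>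
    is the defect of the eigenvalue equation: its squared norm enters linearly in \<open>t\<close>,
    against a quadratic term.\<close>
  have key: "2 * t * inner z z \<le> t\<^sup>2 * k" for t
  proof -
    have le_t: "inner (T (x + t *\<^sub>R z)) (x + t *\<^sub>R z) \<le> r * inner (x + t *\<^sub>R z) (x + t *\<^sub>R z)"
      using le x zS S by (simp add: subspace_add subspace_scale)
    have lhs: "inner (T (x + t *\<^sub>R z)) (x + t *\<^sub>R z) = r + 2 * t * inner (T x) z + t\<^sup>2 * inner (T z) z"
      using adj[of z x] by (simp add: linear_add[OF lin] linear_cmul[OF lin] r_def inner_commute
          algebra_simps power2_eq_square)
    have rhs: "r * inner (x + t *\<^sub>R z) (x + t *\<^sub>R z) = r + 2 * t * r * inner x z + t\<^sup>2 * r * inner z z"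
      using xx by (simp add: inner_commute algebra_simps power2_eq_square)
    have Tz: "inner (T x) z = inner z z + r * inner x z"
      by (subst (2) z_def) (simp add: inner_diff_left)
    show ?thesis using le_t unfolding lhs rhs Tz k_def by (simp add: algebra_simps)
  qed
  have "inner z z = 0"
  proof (rule ccontr)
    assume "inner z z \<noteq> 0"
    then have R: "inner z z > 0" by (metis inner_gt_zero_iff inner_eq_zero_iff)
    \<comment> \<open>So small that the quadratic term is at most half the linear one; the
      \<open>+ 1\<close> keeps the denominator positive.\<close>
    define t where "t = inner z z / (\<bar>k\<bar> + 1)"
    have t: "t > 0" unfolding t_def using R by simp
    have "2 * inner z z \<le> t * k" using key[of t] t by (simp add: power2_eq_square)
    also have "\<dots> \<le> t * (\<bar>k\<bar> + 1)" using t by (intro mult_left_mono) auto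
    also have "\<dots> = inner z z" unfolding t_def by simp
    finally show False using R by simp
  qed
  then have "T x = r *\<^sub>R x" by (simp add: z_def)
  moreover have "x \<noteq> 0" using x by auto
  ultimately show ?thesis using that x by blast
qed

lemma size_filter_mset_sum: "size (filter_mset P (\<Sum>x\<in>X. g x)) = (\<Sum>x\<in>X. size (filter_mset P (g x)))"
  by (induction X rule: infinite_finite_induct) simp_all

lemma size_filter_replicate_mset: "size (filter_mset P (replicate_mset k x)) = (if P x then k else 0)"
  by (induction k) simp_all

text \<open>The inner product is the real part of the Hermitian one; together with complex
  linearity, \<open>adjoint\<close> amounts to Hermitian self-adjointness.\<close>

locale self_adjoint =
  fixes T :: "complex ^ 'n \<Rightarrow> complex ^ 'n::finite"
  assumes add: "T (x + y) = T x + T y"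
    and scale: "T (c *s x) = c *s T x"
    and adjoint: "inner (T x) y = inner x (T y)"
begin

section \<open>Eigenspaces and the spectral theorem\<close>

definition eigenspace :: "real \<Rightarrow> (complex ^ 'n) set" where
  "eigenspace x = {\<phi>. T \<phi> = complex_of_real x *s \<phi>}"

text \<open>Each element comes with a choice of components. The choice is total, also outside
  \<open>X\<close>, so that facts about \<open>f\<close> need no membership side conditions.\<close>

definition eigenspace_sum :: "real set \<Rightarrow> (complex ^ 'n) set" where
  "eigenspace_sum X = {(\<Sum>x\<in>X. f x) |f. \<forall>x. f x \<in> eigenspace x}"

lemma T_zero: "T 0 = 0"
  using scale[of 0 0] by simp

lemma T_sum: "T (\<Sum>x\<in>X. f x) = (\<Sum>x\<in>X. T (f x))"
  by (induction X rule: infinite_finite_induct) (simp_all add: T_zero add)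

lemma T_eigenspace: "\<phi> \<in> eigenspace x \<Longrightarrow> T \<phi> = x *\<^sub>R \<phi>"
  by (simp add: eigenspace_def complex_of_real_scale)

lemma linear_T: "linear T"
  by (rule linearI) (simp_all add: add scale flip: complex_of_real_scale)

lemma subspace_eigenspace: "vec.subspace (eigenspace x)"
  by (rule vec.subspaceI)
    (simp_all add: eigenspace_def T_zero add scale vector_add_ldistrib vec.scale_left_commute vec.scale_right_distrib)

lemma eigenspace_orthogonal:
  assumes "\<phi> \<in> eigenspace x" "\<eta> \<in> eigenspace y" "x \<noteq> y"
  shows "inner \<phi> \<eta> = 0"
proof -
  have "x * inner \<phi> \<eta> = y * inner \<phi> \<eta>"
    using adjoint[of \<phi> \<eta>] by (simp add: T_eigenspace[OF assms(1)] T_eigenspace[OF assms(2)])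
  then show ?thesis using assms(3) by simp
qed

text \<open>Orthogonality leaves only the diagonal terms. Coefficients \<open>1\<close> and
  \<open>x\<close> give the products of a vector and its image under \<open>T\<close>.\<close>

lemma inner_eigenvector_sums:
  assumes "finite X" "\<And>x. f x \<in> eigenspace x"
  shows "inner (\<Sum>x\<in>X. a x *\<^sub>R f x) (\<Sum>x\<in>X. b x *\<^sub>R f x) = (\<Sum>x\<in>X. a x * b x * (norm (f x))\<^sup>2)"
proof -
  have "inner (\<Sum>x\<in>X. a x *\<^sub>R f x) (\<Sum>x\<in>X. b x *\<^sub>R f x)
      = (\<Sum>x\<in>X. \<Sum>y\<in>X. a x * b y * inner (f x) (f y))"
    unfolding inner_sum_left by (simp add: inner_sum_right mult.assoc mult.left_commute)
  also have "\<dots> = (\<Sum>x\<in>X. \<Sum>y\<in>X. if x = y then a x * b y * inner (f x) (f y) else 0)"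
    using eigenspace_orthogonal[OF assms(2) assms(2)] by (intro sum.cong refl) simp
  also have "\<dots> = (\<Sum>x\<in>X. a x * b x * (norm (f x))\<^sup>2)"
    using assms(1) by (simp add: dot_square_norm)
  finally show ?thesis .
qed

lemma subspace_eigenspace_sum: "vec.subspace (eigenspace_sum X)"
proof (rule vec.subspaceI)
  have "\<forall>x. 0 \<in> eigenspace x" using subspace_eigenspace vec.subspace_0 by blast
  then show "0 \<in> eigenspace_sum X"
    unfolding eigenspace_sum_def by (auto intro!: exI[of _ "\<lambda>_. 0"])
next
  fix \<phi> \<eta> assume "\<phi> \<in> eigenspace_sum X" "\<eta> \<in> eigenspace_sum X"
  then obtain f g where f: "\<phi> = (\<Sum>x\<in>X. f x)" "\<forall>x. f x \<in> eigenspace x"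
    and g: "\<eta> = (\<Sum>x\<in>X. g x)" "\<forall>x. g x \<in> eigenspace x"
    unfolding eigenspace_sum_def by blast
  have "\<forall>x. f x + g x \<in> eigenspace x" using f g subspace_eigenspace vec.subspace_add by blast
  then show "\<phi> + \<eta> \<in> eigenspace_sum X"
    unfolding eigenspace_sum_def using f g by (auto intro!: exI[of _ "\<lambda>x. f x + g x"] simp: sum.distrib)
next
  fix c \<phi> assume "\<phi> \<in> eigenspace_sum X"
  then obtain f where f: "\<phi> = (\<Sum>x\<in>X. f x)" "\<forall>x. f x \<in> eigenspace x"
    unfolding eigenspace_sum_def by blast
  have "\<forall>x. c *s f x \<in> eigenspace x" using f subspace_eigenspace vec.subspace_scale by blast
  then show "c *s \<phi> \<in> eigenspace_sum X"
    unfolding eigenspace_sum_def using f by (auto intro!: exI[of _ "\<lambda>x. c *s f x"] simp: vec.scale_sum_right)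
qed

lemma eigenspace_sum_insert:
  assumes "finite X" "x \<notin> X"
  shows "eigenspace_sum (insert x X) = {\<phi> + \<eta> |\<phi> \<eta>. \<phi> \<in> eigenspace x \<and> \<eta> \<in> eigenspace_sum X}"
    (is "_ = ?R")
proof
  show "eigenspace_sum (insert x X) \<subseteq> ?R"
    unfolding eigenspace_sum_def using assms by auto
  show "?R \<subseteq> eigenspace_sum (insert x X)"
  proof
    fix z assume "z \<in> ?R"
    then obtain \<phi> f where f: "\<phi> \<in> eigenspace x" "\<forall>x. f x \<in> eigenspace x" "z = \<phi> + (\<Sum>y\<in>X. f y)"
      unfolding eigenspace_sum_def by blast
    have "(\<Sum>y\<in>X. (f(x := \<phi>)) y) = (\<Sum>y\<in>X. f y)"
      using assms(2) by (intro sum.cong) auto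
    then have "z = (\<Sum>y\<in>insert x X. (f(x := \<phi>)) y)" using f(3) assms by simp
    moreover have "\<forall>y. (f(x := \<phi>)) y \<in> eigenspace y" using f by simp
    ultimately show "z \<in> eigenspace_sum (insert x X)" unfolding eigenspace_sum_def by blast
  qed
qed

lemma eig_mult_eq: "eig_mult T x = vec.dim (eigenspace x)"
  by (simp add: eig_mult_def eigenspace_def)

text \<open>A new eigenspace is orthogonal to the sum of the others, hence meets it only in
  \<open>0\<close>, and dimensions add.\<close>

lemma dim_eigenspace_sum:
  "finite X \<Longrightarrow> vec.dim (eigenspace_sum X) = (\<Sum>x\<in>X. eig_mult T x)"
proof (induction X rule: finite_induct)
  case empty
  have "eigenspace_sum {} = {0}"
    unfolding eigenspace_sum_def
    using subspace_eigenspace[THEN vec.subspace_0] by (auto intro!: exI[of _ "\<lambda>_. 0"])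
  then show ?case by simp
next
  case (insert x X)
  have "inner \<phi> \<phi> = 0" if "\<phi> \<in> eigenspace x" "\<phi> \<in> eigenspace_sum X" for \<phi>
  proof -
    obtain f where f: "\<phi> = (\<Sum>x\<in>X. f x)" "\<forall>x. f x \<in> eigenspace x"
      using \<open>\<phi> \<in> eigenspace_sum X\<close> unfolding eigenspace_sum_def by blast
    have "inner \<phi> (\<Sum>x\<in>X. f x) = 0"
      unfolding inner_sum_right
      by (rule sum.neutral) (use that f insert.hyps eigenspace_orthogonal in metis)
    then show ?thesis using f by simp
  qed
  then have "eigenspace x \<inter> eigenspace_sum X \<subseteq> {0}" by auto
  then have "eigenspace x \<inter> eigenspace_sum X = {0}"
    using subspace_eigenspace[THEN vec.subspace_0] subspace_eigenspace_sum[THEN vec.subspace_0] by blast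
  from dim_sum_disjoint_subspaces[OF subspace_eigenspace subspace_eigenspace_sum this]
  have "vec.dim (eigenspace_sum (insert x X)) = eig_mult T x + vec.dim (eigenspace_sum X)"
    by (simp only: eigenspace_sum_insert[OF insert.hyps] eig_mult_eq)
  then show ?case
    by (simp only: insert.IH sum.insert[OF insert.hyps])
qed

lemma eig_mult_pos: "\<phi> \<in> eigenspace x \<Longrightarrow> \<phi> \<noteq> 0 \<Longrightarrow> 0 < eig_mult T x"
  unfolding eig_mult_eq using vec.dim_eq_0[THEN iffD1, of "eigenspace x"] by (metis gr0I singletonD subsetD)

lemma sum_eig_mult_le: "finite X \<Longrightarrow> (\<Sum>x\<in>X. eig_mult T x) \<le> CARD('n)"
  by (simp add: dim_subset_UNIV_cart_gen flip: dim_eigenspace_sum)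

text \<open>More than \<open>CARD('n)\<close> distinct eigenvalues would exceed the total dimension.
  Finiteness gives the multiset sum in \<open>eigenvalue_list\<close> its intended meaning.\<close>

lemma finite_spectrum: "finite {x. 0 < eig_mult T x}"
proof (rule ccontr)
  assume "infinite {x. 0 < eig_mult T x}"
  then obtain X where X: "finite X" "card X = Suc CARD('n)" "X \<subseteq> {x. 0 < eig_mult T x}"
    using infinite_arbitrarily_large by blast
  have "card X \<le> (\<Sum>x\<in>X. eig_mult T x)"
    unfolding card_eq_sum by (rule sum_mono) (use X in \<open>auto simp: Suc_le_eq\<close>)
  then show False using sum_eig_mult_le[OF X(1)] X(2) by simp
qed

text \<open>The orthogonal complement of all eigenvectors is invariant under \<open>T\<close>; if
  nonzero, it would contain an eigenvector, which would be orthogonal to itself.\<close>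

lemma eigenspace_sum_spectrum: "eigenspace_sum {x. 0 < eig_mult T x} = UNIV"
proof -
  let ?X = "{x. 0 < eig_mult T x}" and ?E = "eigenspace_sum {x. 0 < eig_mult T x}"
  have mem: "\<phi> \<in> ?E" if "\<phi> \<in> eigenspace x" for \<phi> x
  proof (cases "\<phi> = 0")
    case True
    then show ?thesis using subspace_eigenspace_sum vec.subspace_0 by blast
  next
    case False
    then have x: "x \<in> ?X" using eig_mult_pos that by blast
    define f where "f = (\<lambda>y. if y = x then \<phi> else 0)"
    have "(\<Sum>y\<in>?X. f y) = \<phi>" unfolding f_def using x finite_spectrum by simp
    moreover have "\<forall>y. f y \<in> eigenspace y"
      unfolding f_def using that subspace_eigenspace vec.subspace_0 by auto
    ultimately show ?thesis unfolding eigenspace_sum_def by blast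
  qed
  \<comment> \<open>The complement is taken in the real inner product, so the complex subspace is
    also viewed as a real one.\<close>
  have real_sub: "subspace A" if "vec.subspace A" for A :: "(complex ^ 'n) set"
    using that unfolding subspace_def vec.subspace_def by (simp flip: complex_of_real_scale)
  have inv: "T \<phi> \<in> ?E" if \<phi>: "\<phi> \<in> ?E" for \<phi>
  proof -
    obtain f where f: "\<phi> = (\<Sum>x\<in>?X. f x)" "\<forall>x. f x \<in> eigenspace x"
      using \<phi> unfolding eigenspace_sum_def by blast
    have "T \<phi> = (\<Sum>x\<in>?X. complex_of_real x *s f x)"
      unfolding f(1) T_sum by (rule sum.cong) (use f(2) in \<open>auto simp: eigenspace_def\<close>)
    moreover have "\<forall>x. complex_of_real x *s f x \<in> eigenspace x"
      using f(2) subspace_eigenspace vec.subspace_scale by blast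
    ultimately show ?thesis unfolding eigenspace_sum_def by blast
  qed
  define S where "S = {y. \<forall>x\<in>?E. inner x y = 0}"
  have subS: "subspace S"
    unfolding S_def subspace_def by (auto simp: inner_right_distrib)
  have "S = {0}"
  proof (rule ccontr)
    assume "S \<noteq> {0}"
    moreover have "T y \<in> S" if "y \<in> S" for y
      using that inv unfolding S_def by (auto simp: adjoint[symmetric])
    ultimately obtain x r where x: "x \<in> S" "x \<noteq> 0" "T x = r *\<^sub>R x"
      using self_adjoint_eigenvector_exists[OF linear_T adjoint subS] by metis
    then have "x \<in> ?E" using mem[of x r] by (simp add: eigenspace_def complex_of_real_scale)
    then show False using x unfolding S_def by auto
  qed
  show ?thesis
  proof (rule ccontr)
    assume "?E \<noteq> UNIV"
    have sE: "span ?E = ?E" using real_sub[OF subspace_eigenspace_sum] by (rule span_eq_iff[THEN iffD2])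
    have "span ?E \<subset> span UNIV" unfolding sE using \<open>?E \<noteq> UNIV\<close> by (simp add: psubset_eq)
    then obtain y where "y \<noteq> 0" "\<And>x. x \<in> span ?E \<Longrightarrow> orthogonal y x"
      using orthogonal_to_subspace_exists_gen by metis
    then have "y \<in> S" unfolding S_def sE orthogonal_def by (simp add: inner_commute)
    then show False using \<open>S = {0}\<close> \<open>y \<noteq> 0\<close> by blast
  qed
qed

lemma sum_eig_mult: "(\<Sum>x | 0 < eig_mult T x. eig_mult T x) = CARD('n)"
proof -
  have 1: "(\<Sum>x | 0 < eig_mult T x. eig_mult T x) = vec.dim (eigenspace_sum {x. 0 < eig_mult T x})"
    by (rule dim_eigenspace_sum[OF finite_spectrum, symmetric])
  have 2: "vec.dim (eigenspace_sum {x. 0 < eig_mult T x}) = vec.dim (UNIV :: (complex ^ 'n) set)"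
    by (simp only: eigenspace_sum_spectrum)
  have 3: "vec.dim (UNIV :: (complex ^ 'n) set) = CARD('n)"
    by (rule vec_dim_card)
  show ?thesis unfolding 1 2 3 ..
qed

section \<open>From multiplicities to positions in the sorted eigenvalue list\<close>

lemma eigenvalue_list_count:
  "length (filter P (eigenvalue_list T)) = (\<Sum>x | 0 < eig_mult T x \<and> P x. eig_mult T x)"
proof -
  have "length (filter P (eigenvalue_list T)) = size (filter_mset P (mset (eigenvalue_list T)))"
    by (simp flip: mset_filter)
  also have "\<dots> = size (filter_mset P (\<Sum>x | eig_mult T x > 0. replicate_mset (eig_mult T x) x))"
    by (simp only: eigenvalue_list_def mset_sorted_list_of_multiset)
  also have "\<dots> = (\<Sum>x | eig_mult T x > 0. size (filter_mset P (replicate_mset (eig_mult T x) x)))"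
    by (rule size_filter_mset_sum)
  also have "\<dots> = (\<Sum>x | eig_mult T x > 0. if P x then eig_mult T x else 0)"
    by (simp only: size_filter_replicate_mset)
  also have "\<dots> = (\<Sum>x | 0 < eig_mult T x \<and> P x. eig_mult T x)"
    using sum.inter_filter[OF finite_spectrum, of "eig_mult T" P] by simp
  finally show ?thesis .
qed

lemma length_eigenvalue_list: "length (eigenvalue_list T) = CARD('n)"
  using eigenvalue_list_count[of "\<lambda>_. True"] sum_eig_mult by simp

lemma sorted_eigenvalue_list: "sorted (eigenvalue_list T)"
  unfolding eigenvalue_list_def by simp

lemma dim_eigenspace_sum_filter:
  "vec.dim (eigenspace_sum {x. 0 < eig_mult T x \<and> P x}) = length (filter P (eigenvalue_list T))"
proof -
  have "finite {x. 0 < eig_mult T x \<and> P x}"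
    using finite_spectrum by (rule rev_finite_subset) auto
  from dim_eigenspace_sum[OF this] show ?thesis by (simp add: eigenvalue_list_count)
qed

lemma filter_spectrum_le:
  assumes "vec.subspace Y" "eigenspace_sum {x. 0 < eig_mult T x \<and> P x} \<inter> Y = {0}"
  shows "vec.dim Y + length (filter P (eigenvalue_list T)) \<le> CARD('n)"
  using dim_disjoint_subspaces_le[OF subspace_eigenspace_sum assms]
  by (simp add: dim_eigenspace_sum_filter)

text \<open>Here \<open>f x\<close> is the squared norm of the component in the eigenspace of
  \<open>x\<close>, so quadratic inequalities reduce to inequalities between eigenvalues.\<close>

lemma eigenspace_sum_norms:
  assumes "\<phi> \<in> eigenspace_sum {x. 0 < eig_mult T x \<and> P x}"
  obtains f :: "real \<Rightarrow> real" and X where "finite X" "\<And>x. x \<in> X \<Longrightarrow> P x" "\<And>x. 0 \<le> f x"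
    "inner \<phi> \<phi> = (\<Sum>x\<in>X. f x)" "inner (T \<phi>) \<phi> = (\<Sum>x\<in>X. x * f x)"
    "inner (T \<phi>) (T \<phi>) = (\<Sum>x\<in>X. x * x * f x)"
proof -
  define X where "X = {x. 0 < eig_mult T x \<and> P x}"
  have fin: "finite X"
    using finite_spectrum unfolding X_def by (rule rev_finite_subset) auto
  obtain f where f: "\<phi> = (\<Sum>x\<in>X. f x)" "\<And>x. f x \<in> eigenspace x"
    using assms unfolding eigenspace_sum_def X_def by blast
  have 1: "\<phi> = (\<Sum>x\<in>X. 1 *\<^sub>R f x)" using f by simp
  have T: "T \<phi> = (\<Sum>x\<in>X. x *\<^sub>R f x)"
    unfolding f(1) T_sum by (rule sum.cong) (use f(2) T_eigenspace in auto)
  show ?thesis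
  proof (rule that[of X "\<lambda>x. (norm (f x))\<^sup>2"])
    show "inner \<phi> \<phi> = (\<Sum>x\<in>X. (norm (f x))\<^sup>2)"
      using inner_eigenvector_sums[OF fin f(2), of "\<lambda>_. 1" "\<lambda>_. 1"] 1 by simp
    show "inner (T \<phi>) \<phi> = (\<Sum>x\<in>X. x * (norm (f x))\<^sup>2)"
      using inner_eigenvector_sums[OF fin f(2), of "\<lambda>x. x" "\<lambda>_. 1"] 1 T by simp
    show "inner (T \<phi>) (T \<phi>) = (\<Sum>x\<in>X. x * x * (norm (f x))\<^sup>2)"
      using inner_eigenvector_sums[OF fin f(2), of "\<lambda>x. x" "\<lambda>x. x"] T by simp
  qed (use fin X_def in auto)
qed

text \<open>On the sum of eigenspaces with eigenvalue at most \<open>t\<close> the Rayleigh quotient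
  is at most \<open>t\<close>, so this sum meets \<open>Y\<close> only in \<open>0\<close>. Hence at
  most \<open>CARD('n) - vec.dim Y\<close> eigenvalues are at most \<open>t\<close>.\<close>

lemma less_eigval:
  assumes Y: "vec.subspace Y" and pos: "\<And>\<phi>. \<phi> \<in> Y \<Longrightarrow> \<phi> \<noteq> 0 \<Longrightarrow> t * inner \<phi> \<phi> < inner (T \<phi>) \<phi>"
    and j: "int CARD('n) - int (vec.dim Y) < j" "1 \<le> j" "j \<le> int CARD('n)"
  shows "t < eigval T j"
proof (rule ccontr)
  assume n: "\<not> t < eigval T j"
  let ?xs = "eigenvalue_list T"
  have j': "nat (j - 1) < length ?xs" using j by (simp add: length_eigenvalue_list)
  have "{0} = eigenspace_sum {x. 0 < eig_mult T x \<and> x \<le> t} \<inter> Y"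
  proof (intro equalityI subsetI)
    fix \<phi> assume \<phi>: "\<phi> \<in> eigenspace_sum {x. 0 < eig_mult T x \<and> x \<le> t} \<inter> Y"
    obtain f X where "finite X" and f: "\<And>x. x \<in> X \<Longrightarrow> x \<le> t" "\<And>x. 0 \<le> f x"
      "inner \<phi> \<phi> = (\<Sum>x\<in>X. f x)" "inner (T \<phi>) \<phi> = (\<Sum>x\<in>X. x * f x)"
      "inner (T \<phi>) (T \<phi>) = (\<Sum>x\<in>X. x * x * f x)"
      by (rule eigenspace_sum_norms[OF IntD1[OF \<phi>]]) (rule that)
    have "inner (T \<phi>) \<phi> \<le> t * inner \<phi> \<phi>"
      unfolding f sum_distrib_left by (intro sum_mono mult_right_mono f)
    then show "\<phi> \<in> {0}" using pos \<phi> by force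
  qed (simp add: vec.subspace_0[OF Y] vec.subspace_0[OF subspace_eigenspace_sum])
  from filter_spectrum_le[OF Y this[symmetric]]
  have le: "vec.dim Y + length (filter (\<lambda>x. x \<le> t) ?xs) \<le> CARD('n)" .
  \<comment> \<open>By sortedness the first \<open>j\<close> entries are all at most
    \<open>t\<close>; list positions start at \<open>0\<close>.\<close>
  have "{..nat (j - 1)} \<subseteq> {i. i < length ?xs \<and> ?xs ! i \<le> t}"
    using n j' sorted_nth_mono[OF sorted_eigenvalue_list, of _ "nat (j - 1)"]
    unfolding eigval_def by fastforce
  then have "card {..nat (j - 1)} \<le> length (filter (\<lambda>x. x \<le> t) ?xs)"
    unfolding length_filter_conv_card by (intro card_mono) auto
  then show False using le j by simp
qed

text \<open>Comparing \<open>T \<phi>\<close> with \<open>\<phi>\<close> through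
  \<open>inner (T \<phi>) (T \<phi>)\<close> lets \<open>Y\<close> contain kernel vectors. On the
  sum of eigenspaces with eigenvalue at least \<open>t\<close> the reverse inequality holds, which
  forces \<open>T \<phi> = 0\<close> and then, as \<open>t > 0\<close>,
  \<open>\<phi> = 0\<close>.\<close>

lemma eigval_less:
  assumes t: "0 < t" and Y: "vec.subspace Y"
    and neg: "\<And>\<phi>. \<phi> \<in> Y \<Longrightarrow> T \<phi> \<noteq> 0 \<Longrightarrow> inner (T \<phi>) (T \<phi>) < t * inner (T \<phi>) \<phi>"
    and j: "j \<le> int (vec.dim Y)" "1 \<le> j" "j \<le> int CARD('n)"
  shows "eigval T j < t"
proof (rule ccontr)
  assume n: "\<not> eigval T j < t"
  let ?xs = "eigenvalue_list T"
  have j': "nat (j - 1) < length ?xs" using j by (simp add: length_eigenvalue_list)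
  have "{0} = eigenspace_sum {x. 0 < eig_mult T x \<and> t \<le> x} \<inter> Y"
  proof (intro equalityI subsetI)
    fix \<phi> assume \<phi>: "\<phi> \<in> eigenspace_sum {x. 0 < eig_mult T x \<and> t \<le> x} \<inter> Y"
    obtain f X where "finite X" and f: "\<And>x. x \<in> X \<Longrightarrow> t \<le> x" "\<And>x. 0 \<le> f x"
      "inner \<phi> \<phi> = (\<Sum>x\<in>X. f x)" "inner (T \<phi>) \<phi> = (\<Sum>x\<in>X. x * f x)"
      "inner (T \<phi>) (T \<phi>) = (\<Sum>x\<in>X. x * x * f x)"
      by (rule eigenspace_sum_norms[OF IntD1[OF \<phi>]]) (rule that)
    have 1: "t * inner \<phi> \<phi> \<le> inner (T \<phi>) \<phi>"
      unfolding f sum_distrib_left by (intro sum_mono mult_right_mono f)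
    have "t * inner (T \<phi>) \<phi> \<le> inner (T \<phi>) (T \<phi>)"
      unfolding f sum_distrib_left mult.assoc[symmetric]
      by (intro sum_mono mult_right_mono f) (use f(1) t in force)+
    then have "T \<phi> = 0" using neg \<phi> by force
    then have "inner \<phi> \<phi> \<le> 0" using 1 t by (simp add: mult_le_0_iff)
    then show "\<phi> \<in> {0}" by (metis inner_gt_zero_iff linorder_not_le singletonI)
  qed (simp add: vec.subspace_0[OF Y] vec.subspace_0[OF subspace_eigenspace_sum])
  from filter_spectrum_le[OF Y this[symmetric]]
  have le: "vec.dim Y + length (filter (\<lambda>x. t \<le> x) ?xs) \<le> CARD('n)" .
  have "{nat (j - 1)..<length ?xs} \<subseteq> {i. i < length ?xs \<and> t \<le> ?xs ! i}"
    using n sorted_nth_mono[OF sorted_eigenvalue_list, of "nat (j - 1)"]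
    unfolding eigval_def by fastforce
  then have "card {nat (j - 1)..<length ?xs} \<le> length (filter (\<lambda>x. t \<le> x) ?xs)"
    unfolding length_filter_conv_card by (intro card_mono) auto
  then show False using le j by (simp add: length_eigenvalue_list)
qed

end

section \<open>The magnetic coboundary\<close>

locale magnetic_graph =
  fixes G :: "'v::finite pair_pre_digraph" and \<alpha> :: "'v \<times> 'v \<Rightarrow> real"
  assumes pair_graph: "pair_graph G"
    and pverts: "pverts G = UNIV"
    and connected: "Digraph_Component.connected (with_proj G)"
    and magnetic: "magnetic_potential G \<alpha>"
begin

definition coboundary :: "complex ^ 'v \<Rightarrow> 'v \<times> 'v \<Rightarrow> complex" where
  "coboundary \<phi> e = \<phi> $ fst e - cis (\<alpha> e) * \<phi> $ snd e"

text \<open>On covariant functions this is the adjoint of \<open>coboundary\<close>, once edges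
  rather than arcs are counted.\<close>

definition boundary :: "('v \<times> 'v \<Rightarrow> complex) \<Rightarrow> complex ^ 'v" where
  "boundary \<psi> = (\<chi> v. \<Sum>e | e \<in> parcs G \<and> fst e = v. \<psi> e)"

text \<open>
  Functions on arcs with this symmetry are determined by one value per edge; their inner product
  counts each edge twice.
\<close>
definition covariant :: "('v \<times> 'v \<Rightarrow> complex) \<Rightarrow> bool" where
  "covariant \<psi> \<longleftrightarrow> (\<forall>e\<in>parcs G. \<psi> (prod.swap e) = - (cis (- \<alpha> e) * \<psi> e))"

lemma swap_arc: "prod.swap e \<in> parcs G \<longleftrightarrow> e \<in> parcs G"
proof -
  have "sym (parcs G)"
    using pair_sym_digraph.pair_sym_arcs[OF pair_pseudo_graph.axioms(2)[OF pair_graph.axioms(2)[OF pair_graph]]]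
    by (simp add: symmetric_def)
  then show ?thesis by (cases e) (auto dest: symD)
qed

lemma no_loop: "e \<in> parcs G \<Longrightarrow> fst e \<noteq> snd e"
  using pair_loopfree_digraph.pair_no_loops[OF pair_digraph.axioms(2)[OF pair_graph.axioms(1)[OF pair_graph]]] .

text \<open>Antisymmetry holds only modulo \<open>2 * pi\<close>, an ambiguity that
  \<open>cis\<close> removes.\<close>

lemma cis_swap: "e \<in> parcs G \<Longrightarrow> cis (\<alpha> (prod.swap e)) = cis (- \<alpha> e)"
  using magnetic unfolding magnetic_potential_def by (simp add: cis_eq_iff)

lemma cis_cancel [simp]: "cis a * (cis (- a) * z) = z" "cis (- a) * (cis a * z) = z"
  by (simp_all add: cis_mult flip: mult.assoc)

lemma coboundary_add: "coboundary (\<phi> + \<eta>) e = coboundary \<phi> e + coboundary \<eta> e"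
  and coboundary_scale: "coboundary (c *s \<phi>) e = c * coboundary \<phi> e"
  by (simp_all add: coboundary_def algebra_simps)

lemma boundary_add: "boundary (\<lambda>e. \<psi> e + \<xi> e) = boundary \<psi> + boundary \<xi>"
  and boundary_scale: "boundary (\<lambda>e. c * \<psi> e) = c *s boundary \<psi>"
  by (simp_all add: boundary_def vec_eq_iff sum.distrib sum_distrib_left)

lemma boundary_cong: "(\<And>e. e \<in> parcs G \<Longrightarrow> \<psi> e = \<xi> e) \<Longrightarrow> boundary \<psi> = boundary \<xi>"
  by (simp add: boundary_def)

lemma covariant_coboundary: "covariant (coboundary \<phi>)"
  unfolding covariant_def
  by (auto simp: coboundary_def cis_swap algebra_simps)

lemma laplacian_eq: "magnetic_laplacian G \<alpha> \<phi> = boundary (coboundary \<phi>)"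
proof -
  have "out_arcs (with_proj G) v = {e. e \<in> parcs G \<and> fst e = v}" for v
    by (auto simp: out_arcs_def)
  then show ?thesis
    by (simp add: magnetic_laplacian_def boundary_def coboundary_def out_degree_def sum_subtractf)
qed

lemma sum_by_tail: "(\<Sum>v\<in>UNIV. \<Sum>e | e \<in> parcs G \<and> fst e = v. h e v) = (\<Sum>e\<in>parcs G. h e (fst e))"
  for h :: "'v \<times> 'v \<Rightarrow> 'v \<Rightarrow> real"
proof -
  have "(\<Sum>v\<in>UNIV. \<Sum>e | e \<in> parcs G \<and> fst e = v. h e v)
      = (\<Sum>v\<in>UNIV. \<Sum>e | e \<in> parcs G \<and> fst e = v. h e (fst e))"
    by (intro sum.cong) auto
  also have "\<dots> = (\<Sum>e\<in>parcs G. h e (fst e))"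
    by (rule sum.group) auto
  finally show ?thesis .
qed

text \<open>Reversing all arcs and using covariance rewrites the pairing at the tails as minus the
  twisted pairing at the heads. The sum of both expressions is the pairing with the coboundary,
  whence the factor \<open>2\<close>.\<close>

lemma inner_boundary:
  assumes "covariant \<psi>"
  shows "2 * inner (boundary \<psi>) \<eta> = (\<Sum>e\<in>parcs G. inner (\<psi> e) (coboundary \<eta> e))"
proof -
  have 1: "inner (boundary \<psi>) \<eta> = (\<Sum>e\<in>parcs G. inner (\<psi> e) (\<eta> $ fst e))"
    by (simp add: inner_vec_def boundary_def inner_sum_left sum_by_tail)
  also have "\<dots> = (\<Sum>e\<in>parcs G. inner (\<psi> (prod.swap e)) (\<eta> $ snd e))"
    by (rule sum.reindex_bij_witness[of _ prod.swap prod.swap]) (auto simp: swap_arc)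
  also have "\<dots> = (\<Sum>e\<in>parcs G. - inner (\<psi> e) (cis (\<alpha> e) * \<eta> $ snd e))"
    using assms by (intro sum.cong refl) (simp add: covariant_def inner_complex_mult_left cis_cnj)
  finally have 2: "inner (boundary \<psi>) \<eta> = \<dots>" .
  have "2 * inner (boundary \<psi>) \<eta> = inner (boundary \<psi>) \<eta> + inner (boundary \<psi>) \<eta>" by simp
  also have "\<dots> = (\<Sum>e\<in>parcs G. inner (\<psi> e) (coboundary \<eta> e))"
    unfolding coboundary_def inner_diff_right sum_subtractf by (subst 1, subst 2) (simp add: sum_negf)
  finally show ?thesis .
qed

text \<open>Cauchy-Schwarz at each vertex, with the degree bounded by the number of vertices because
  an arc is determined by its ends.\<close>

lemma norm_boundary_le:
  "inner (boundary \<psi>) (boundary \<psi>) \<le> CARD('v) * (\<Sum>e\<in>parcs G. inner (\<psi> e) (\<psi> e))"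
proof -
  have deg: "card {e. e \<in> parcs G \<and> fst e = v} \<le> CARD('v)" for v
  proof (rule card_inj_on_le[of snd])
    show "inj_on snd {e. e \<in> parcs G \<and> fst e = v}" by (auto simp: inj_on_def prod_eq_iff)
  qed auto
  have "inner (boundary \<psi>) (boundary \<psi>) = (\<Sum>v\<in>UNIV. (cmod (\<Sum>e | e \<in> parcs G \<and> fst e = v. \<psi> e))\<^sup>2)"
    by (simp add: inner_vec_def boundary_def dot_square_norm)
  also have "\<dots> \<le> (\<Sum>v\<in>UNIV. \<Sum>e | e \<in> parcs G \<and> fst e = v. CARD('v) * (cmod (\<psi> e))\<^sup>2)"
  proof (rule sum_mono)
    fix v :: 'v
    let ?O = "{e. e \<in> parcs G \<and> fst e = v}"
    have "(cmod (\<Sum>e\<in>?O. \<psi> e))\<^sup>2 \<le> (\<Sum>e\<in>?O. cmod (\<psi> e))\<^sup>2"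
      by (intro power_mono norm_sum) simp
    also have "\<dots> \<le> (\<Sum>e\<in>?O. (cmod (\<psi> e))\<^sup>2) * card ?O"
      by (rule sum_squared_le_sum_of_squares)
    also have "\<dots> \<le> (\<Sum>e\<in>?O. (cmod (\<psi> e))\<^sup>2) * CARD('v)"
      using deg[of v] by (intro mult_left_mono) (simp_all add: sum_nonneg)
    finally show "(cmod (\<Sum>e\<in>?O. \<psi> e))\<^sup>2 \<le> (\<Sum>e\<in>?O. CARD('v) * (cmod (\<psi> e))\<^sup>2)"
      by (simp add: sum_distrib_left mult.commute)
  qed
  finally show ?thesis by (simp add: sum_by_tail sum_distrib_left dot_square_norm)
qed

lemma constant_norm_imp_zero:
  assumes arc: "\<And>e. e \<in> parcs G \<Longrightarrow> norm (g $ fst e) = norm (g $ snd e)" and u: "g $ u = 0"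
  shows "g = (0 :: complex ^ 'v)"
proof -
  have "g $ v = 0" for v
  proof -
    \<comment> \<open>Connectedness means strong connectedness of the symmetrised graph, so the zero
      at \<open>u\<close> is carried along a path whose steps are arcs of \<open>G\<close> in one
      direction or the other.\<close>
    have "u \<rightarrow>\<^sup>*\<^bsub>with_proj (mk_symmetric (with_proj G))\<^esub> v"
      using connected unfolding connected_def strongly_connected_def by (simp add: pverts)
    then have "(u, v) \<in> rtrancl_on UNIV (parcs (mk_symmetric (with_proj G)))"
      by (simp add: reachable_def pverts)
    then show ?thesis using u
    proof (induction rule: rtrancl_on.induct)
      case (rtrancl_on_into_rtrancl_on a b c)
      then have "(b, c) \<in> parcs G \<or> (c, b) \<in> parcs G"
        by (auto simp: parcs_mk_symmetric)
      then have "norm (g $ b) = norm (g $ c)"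
        using arc[of "(b, c)"] arc[of "(c, b)"] by auto
      then show ?case using rtrancl_on_into_rtrancl_on by simp
    qed simp
  qed
  then show ?thesis by (simp add: vec_eq_iff)
qed

end

section \<open>Matchings\<close>

locale magnetic_matching = magnetic_graph +
  fixes M :: "'a set set"
  assumes matching: "matching G M"
begin

definition matched_arcs :: "('a \<times> 'a) set" where
  "matched_arcs = {e \<in> parcs G. {fst e, snd e} \<in> M}"

definition restrict_matching :: "('a \<times> 'a \<Rightarrow> complex) \<Rightarrow> 'a \<times> 'a \<Rightarrow> complex" where
  "restrict_matching \<psi> e = (if {fst e, snd e} \<in> M then \<psi> e else 0)"

text \<open>These are the vectors with eigenvalue 2, together with \<open>0\<close>, for the
  magnetic Laplacian of the spanning subgraph with edge set \<open>M\<close>.\<close>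

definition alternating :: "complex ^ 'a \<Rightarrow> bool" where
  "alternating g \<longleftrightarrow> (\<forall>e\<in>matched_arcs. g $ fst e = - (cis (\<alpha> e) * g $ snd e)) \<and> (\<forall>v. v \<notin> \<Union>M \<longrightarrow> g $ v = 0)"

lemma swap_matched: "prod.swap e \<in> matched_arcs \<longleftrightarrow> e \<in> matched_arcs"
  by (auto simp: matched_arcs_def swap_arc insert_commute)

lemma matched_arc: "e \<in> matched_arcs \<Longrightarrow> e \<in> parcs G"
  by (simp add: matched_arcs_def)

lemma matching_subset: "s \<in> M \<Longrightarrow> s \<in> uedges G"
  using matching by (auto simp: matching_def)

lemma uedges_cases:
  assumes "s \<in> uedges G"
  obtains e where "e \<in> parcs G" "s = {fst e, snd e}"
  using assms unfolding uedges_def by force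

text \<open>Matched edges with a common tail are not disjoint, hence equal; without loops the tail
  also fixes the orientation.\<close>

lemma matched_arc_unique:
  assumes e: "e \<in> matched_arcs" and e': "e' \<in> parcs G" "{fst e', snd e'} \<in> M" and eq: "fst e = fst e'"
  shows "e' = e"
proof -
  have s: "{fst e, snd e} \<in> M" and p: "e \<in> parcs G" using e by (auto simp: matched_arcs_def)
  have "pairwise disjnt M" using matching by (simp add: matching_def)
  moreover have "\<not> disjnt {fst e, snd e} {fst e', snd e'}" using eq by (auto simp: disjnt_def)
  ultimately have "{fst e, snd e} = {fst e', snd e'}"
    using s e'(2) by (meson pairwiseD)
  then show ?thesis using no_loop[OF p] no_loop[OF e'(1)] eq by (auto simp: prod_eq_iff doubleton_eq_iff)
qed

lemma tails_matched: "fst ` matched_arcs = \<Union>M"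
proof
  show "fst ` matched_arcs \<subseteq> \<Union>M" by (auto simp: matched_arcs_def)
  show "\<Union>M \<subseteq> fst ` matched_arcs"
  proof
    fix v assume "v \<in> \<Union>M"
    then obtain s where s: "v \<in> s" "s \<in> M" by blast
    obtain e where e: "e \<in> parcs G" "s = {fst e, snd e}"
      using uedges_cases[OF matching_subset[OF s(2)]] .
    then have m: "e \<in> matched_arcs" using s by (simp add: matched_arcs_def)
    have "v = fst e \<or> v = fst (prod.swap e)" using s e by auto
    then show "v \<in> fst ` matched_arcs" using m swap_matched by (metis imageI)
  qed
qed

lemma inj_tails_matched: "inj_on fst matched_arcs"
  using matched_arc_unique by (auto simp: inj_on_def matched_arcs_def)

text \<open>The tails of matched arcs run through \<open>\<Union>M\<close> exactly once, and
  \<open>g\<close> vanishes elsewhere.\<close>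

lemma sum_alternating:
  assumes "alternating g"
  shows "(\<Sum>e\<in>matched_arcs. inner (g $ fst e) (g $ fst e)) = inner g g"
proof -
  have "(\<Sum>e\<in>matched_arcs. inner (g $ fst e) (g $ fst e)) = (\<Sum>v\<in>\<Union>M. inner (g $ v) (g $ v))"
    by (simp add: sum.reindex[OF inj_tails_matched] flip: tails_matched)
  also have "\<dots> = (\<Sum>v\<in>UNIV. inner (g $ v) (g $ v))"
    using assms by (intro sum.mono_neutral_left) (auto simp: alternating_def)
  finally show ?thesis by (simp add: inner_vec_def)
qed

lemma sum_arcs_split: "(\<Sum>e\<in>parcs G. h e) = (\<Sum>e\<in>matched_arcs. h e) + (\<Sum>e\<in>parcs G - matched_arcs. h e)"
  for h :: "'a \<times> 'a \<Rightarrow> real"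
  using sum.subset_diff[of matched_arcs "parcs G" h] by (auto simp: matched_arcs_def add.commute)

lemma coboundary_alternating:
  "alternating g \<Longrightarrow> e \<in> matched_arcs \<Longrightarrow> coboundary g e = 2 * g $ fst e"
  by (simp add: alternating_def coboundary_def)

text \<open>
  Connectedness makes the absolute value of \<open>g\<close> constant: the alternation handles the matched
  arcs, the vanishing coboundary the others.
\<close>
lemma alternating_rigid:
  assumes g: "alternating g" and d: "\<And>e. e \<in> parcs G - matched_arcs \<Longrightarrow> coboundary g e = 0"
    and u: "g $ u = 0"
  shows "g = 0"
proof (rule constant_norm_imp_zero[OF _ u])
  fix e assume e: "e \<in> parcs G"
  have "g $ fst e = - (cis (\<alpha> e) * g $ snd e) \<or> g $ fst e = cis (\<alpha> e) * g $ snd e"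
    using g d[of e] e by (auto simp: alternating_def coboundary_def)
  then show "norm (g $ fst e) = norm (g $ snd e)" by (auto simp: norm_mult)
qed

lemma restricted_boundary_fst:
  assumes "e \<in> matched_arcs"
  shows "boundary (restrict_matching \<psi>) $ fst e = \<psi> e"
proof -
  have "(\<Sum>e' | e' \<in> parcs G \<and> fst e' = fst e. restrict_matching \<psi> e') = (\<Sum>e' \<in> {e}. restrict_matching \<psi> e')"
    using assms matched_arc_unique[OF assms] matched_arc[OF assms]
    by (intro sum.mono_neutral_right) (auto simp: restrict_matching_def)
  then show ?thesis using assms by (simp add: boundary_def restrict_matching_def matched_arcs_def)
qed

text \<open>At a matched vertex the boundary is the value on its only matched arc, so covariance
  turns into alternation.\<close>

lemma alternating_restricted_boundary:
  assumes "covariant \<psi>"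
  shows "alternating (boundary (restrict_matching \<psi>))"
  unfolding alternating_def
proof (intro conjI ballI allI impI)
  fix e assume e: "e \<in> matched_arcs"
  have "boundary (restrict_matching \<psi>) $ snd e = \<psi> (prod.swap e)"
    using restricted_boundary_fst[of "prod.swap e" \<psi>] e by (simp add: swap_matched)
  then show "boundary (restrict_matching \<psi>) $ fst e = - (cis (\<alpha> e) * boundary (restrict_matching \<psi>) $ snd e)"
    using assms restricted_boundary_fst[OF e] matched_arc[OF e] by (simp add: covariant_def)
next
  fix v assume v: "v \<notin> \<Union>M"
  have "(\<Sum>e | e \<in> parcs G \<and> fst e = v. restrict_matching \<psi> e) = 0"
    by (intro sum.neutral) (use v in \<open>auto simp: restrict_matching_def\<close>)
  then show "boundary (restrict_matching \<psi>) $ v = 0" by (simp add: boundary_def)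
qed

text \<open>The matched arcs alone contribute exactly \<open>2 * inner g g\<close>. By rigidity some
  unmatched arc has nonzero coboundary, which makes the inequality strict.\<close>

lemma laplacian_alternating_pos:
  assumes g: "alternating g" "g $ u = 0" "g \<noteq> 0"
  shows "2 * inner g g < inner (magnetic_laplacian G \<alpha> g) g"
proof -
  have four: "inner (2 * z) (2 * z) = 4 * inner z z" for z :: complex
    by (simp add: inner_complex_def)
  have "2 * inner (magnetic_laplacian G \<alpha> g) g = (\<Sum>e\<in>parcs G. inner (coboundary g e) (coboundary g e))"
    unfolding laplacian_eq by (rule inner_boundary[OF covariant_coboundary])
  also have "\<dots> = (\<Sum>e\<in>matched_arcs. 4 * inner (g $ fst e) (g $ fst e))
      + (\<Sum>e\<in>parcs G - matched_arcs. inner (coboundary g e) (coboundary g e))"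
    unfolding sum_arcs_split by (simp add: coboundary_alternating[OF g(1)] four)
  also have "\<dots> = 4 * inner g g + (\<Sum>e\<in>parcs G - matched_arcs. inner (coboundary g e) (coboundary g e))"
    by (simp add: sum_alternating[OF g(1)] flip: sum_distrib_left)
  finally have eq: "2 * inner (magnetic_laplacian G \<alpha> g) g = \<dots>" .
  obtain f where f: "f \<in> parcs G - matched_arcs" "coboundary g f \<noteq> 0"
    using alternating_rigid[OF g(1) _ g(2)] g(3) by blast
  have "0 < (\<Sum>e\<in>parcs G - matched_arcs. inner (coboundary g e) (coboundary g e))"
    by (rule sum_pos2[OF _ f(1)]) (use f in auto)
  then show ?thesis using eq by simp
qed

text \<open>This is the magnetic Laplacian of the subgraph with edge set \<open>M\<close>, applied
  to \<open>\<phi>\<close>.\<close>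

abbreviation matched_part :: "complex ^ 'a \<Rightarrow> complex ^ 'a" where
  "matched_part \<phi> \<equiv> boundary (restrict_matching (coboundary \<phi>))"

text \<open>
  The value \<open>1 / CARD('a)\<close> is small enough for the quadratic error term, which is controlled by the
  maximal degree.
\<close>
lemma laplacian_square_less:
  assumes \<phi>: "\<And>e. e \<in> parcs G - matched_arcs \<Longrightarrow>
      coboundary \<phi> e + of_real (1 / CARD('a)) * coboundary (matched_part \<phi>) e = 0"
    and u: "matched_part \<phi> $ u = 0" and ne: "magnetic_laplacian G \<alpha> \<phi> \<noteq> 0"
  shows "inner (magnetic_laplacian G \<alpha> \<phi>) (magnetic_laplacian G \<alpha> \<phi>)
    < 2 * inner (magnetic_laplacian G \<alpha> \<phi>) \<phi>"
proof -
  define g where "g = matched_part \<phi>"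
  define r :: real where "r = 1 / CARD('a)"
  define h where "h e = (if e \<in> matched_arcs then 0 else coboundary g e)" for e
  define b where "b = boundary h"
  define q where "q = (\<Sum>e\<in>parcs G. inner (h e) (h e))"
  have r: "r > 0" "CARD('a) * r = 1" by (simp_all add: r_def)
  have alt: "alternating g"
    unfolding g_def by (rule alternating_restricted_boundary[OF covariant_coboundary])
  have h_cov: "covariant h"
    using covariant_coboundary[of g] by (simp add: covariant_def h_def swap_matched)
  have arc: "coboundary \<phi> e = restrict_matching (coboundary \<phi>) e + of_real (- r) * h e" if "e \<in> parcs G" for e
  proof (cases "e \<in> matched_arcs")
    case True
    then show ?thesis by (simp add: restrict_matching_def h_def matched_arcs_def)
  next
    case False
    then show ?thesis
      using \<phi>[of e] that by (simp add: restrict_matching_def h_def matched_arcs_def r_def g_def eq_neg_iff_add_eq_0)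
  qed
  have L: "magnetic_laplacian G \<alpha> \<phi> = g - r *\<^sub>R b"
  proof -
    have "magnetic_laplacian G \<alpha> \<phi> = boundary (\<lambda>e. restrict_matching (coboundary \<phi>) e + of_real (- r) * h e)"
      unfolding laplacian_eq by (rule boundary_cong) (rule arc)
    also have "\<dots> = g - r *\<^sub>R b"
      unfolding boundary_add boundary_scale g_def b_def
      by (simp add: vec_eq_iff) (simp add: scaleR_conv_of_real)
    finally show ?thesis .
  qed
  \<comment> \<open>Off the matching \<open>h\<close> is the coboundary of \<open>g\<close>, so this
    pairing is the squared norm of \<open>h\<close> over arcs: the first-order gain.\<close>
  have bg: "2 * inner b g = q"
    unfolding b_def inner_boundary[OF h_cov] q_def by (intro sum.cong) (simp_all add: h_def)
  have bb: "inner b b \<le> CARD('a) * q"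
    unfolding b_def q_def by (rule norm_boundary_le)
  have "2 * inner (magnetic_laplacian G \<alpha> \<phi>) \<phi> = (\<Sum>e\<in>parcs G. inner (coboundary \<phi> e) (coboundary \<phi> e))"
    unfolding laplacian_eq by (rule inner_boundary[OF covariant_coboundary])
  also have "\<dots> = (\<Sum>e\<in>matched_arcs. inner (g $ fst e) (g $ fst e))
      + (\<Sum>e\<in>parcs G - matched_arcs. r\<^sup>2 * inner (h e) (h e))"
  proof -
    have "inner (coboundary \<phi> e) (coboundary \<phi> e) = r\<^sup>2 * inner (h e) (h e)" if "e \<in> parcs G - matched_arcs" for e
    proof -
      have "coboundary \<phi> e = (- r) *\<^sub>R h e"
        using arc[of e] that by (simp add: restrict_matching_def matched_arcs_def scaleR_conv_of_real)
      then show ?thesis by (simp add: power2_eq_square)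
    qed
    then show ?thesis
      unfolding sum_arcs_split by (simp add: restricted_boundary_fst g_def)
  qed
  also have "(\<Sum>e\<in>parcs G - matched_arcs. r\<^sup>2 * inner (h e) (h e)) = r\<^sup>2 * q"
    unfolding q_def sum_arcs_split sum_distrib_left[symmetric] by (simp add: h_def)
  finally have Lphi: "2 * inner (magnetic_laplacian G \<alpha> \<phi>) \<phi> = inner g g + r\<^sup>2 * q"
    by (simp add: sum_alternating[OF alt])
  \<comment> \<open>Compared with \<open>Lphi\<close>, the term \<open>inner g g\<close> is common.
    What remains is that \<open>- r * q + r\<^sup>2 * inner b b\<close>, which the choice of
    \<open>r\<close> makes at most \<open>0\<close>, is below \<open>r\<^sup>2 * q\<close>.\<close>
  have LL: "inner (magnetic_laplacian G \<alpha> \<phi>) (magnetic_laplacian G \<alpha> \<phi>) = inner g g - r * q + r\<^sup>2 * inner b b"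
    using bg unfolding L by (simp add: inner_commute algebra_simps power2_eq_square)
  \<comment> \<open>Otherwise \<open>b = 0\<close>, and rigidity gives \<open>g = 0\<close>, so the
    Laplacian of \<open>\<phi>\<close> would vanish.\<close>
  have "q \<noteq> 0"
  proof
    assume "q = 0"
    then have h0: "h e = 0" if "e \<in> parcs G" for e
      using that unfolding q_def by (subst (asm) sum_nonneg_eq_0_iff) auto
    then have "b = 0" unfolding b_def by (simp add: boundary_def vec_eq_iff)
    moreover have "g = 0"
    proof (rule alternating_rigid[OF alt])
      show "coboundary g e = 0" if "e \<in> parcs G - matched_arcs" for e
        using h0[of e] that by (simp add: h_def)
    qed (use u g_def in simp)
    ultimately show False using L ne by simp
  qed
  moreover have "0 \<le> q" unfolding q_def by (intro sum_nonneg) simp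
  ultimately have "0 < r\<^sup>2 * q" using r by simp
  moreover have "r\<^sup>2 * inner b b \<le> r * q"
  proof -
    have "r\<^sup>2 * inner b b \<le> r\<^sup>2 * (CARD('a) * q)"
      using bb by (rule mult_left_mono) simp
    also have "\<dots> = r * (CARD('a) * r) * q" by (simp add: power2_eq_square)
    finally show ?thesis using r by simp
  qed
  ultimately show ?thesis unfolding LL Lphi by simp
qed

section \<open>Counting linear conditions on vertices and edges\<close>

text \<open>One orientation is chosen per edge, so that an edge is counted as one linear condition
  although it carries two arcs.\<close>

definition edge_arc :: "'a set \<Rightarrow> 'a \<times> 'a" where
  "edge_arc s = (SOME e. e \<in> parcs G \<and> {fst e, snd e} = s)"

lemma edge_arc:
  assumes "e \<in> parcs G"
  shows "edge_arc {fst e, snd e} = e \<or> edge_arc {fst e, snd e} = prod.swap e"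
proof -
  define f where "f = edge_arc {fst e, snd e}"
  have "\<exists>e'. e' \<in> parcs G \<and> {fst e', snd e'} = {fst e, snd e}" using assms by blast
  then have "{fst f, snd f} = {fst e, snd e}"
    unfolding f_def edge_arc_def by (rule someI2_ex) simp
  then have "fst f = fst e \<and> snd f = snd e \<or> fst f = snd e \<and> snd f = fst e"
    by (simp only: doubleton_eq_iff)
  then have "f = e \<or> f = prod.swap e" by (simp add: prod_eq_iff)
  then show ?thesis by (simp only: f_def)
qed

lemma card_matched_vertices: "card (\<Union>M) = 2 * card M"
proof -
  have two: "card s = 2" "finite s" if s: "s \<in> M" for s
  proof -
    obtain e where e: "e \<in> parcs G" "s = {fst e, snd e}"
      using uedges_cases[OF matching_subset[OF s]] .
    show "card s = 2" "finite s" unfolding e(2) by (simp_all add: no_loop[OF e(1)])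
  qed
  have "card (\<Union>M) = sum card M"
    using matching two(2) unfolding matching_def by (intro card_Union_disjoint) auto
  then show ?thesis using two(1) by simp
qed

lemma card_matching_le: "card M \<le> card (uedges G)"
  using matching unfolding matching_def by (intro card_mono) auto

text \<open>There is one condition per matched edge, one for each of the
  \<open>CARD('a) - 2 * card M\<close> unmatched vertices and one per element of
  \<open>W\<close>.\<close>

lemma dim_alternating:
  defines "Y \<equiv> \<lambda>W. {\<phi>. alternating \<phi> \<and> (\<forall>w\<in>W. \<phi> $ w = 0)}"
  shows "vec.subspace (Y W) \<and> int (card M) - int (card W) \<le> int (vec.dim (Y W))"
proof -
  define l where "l = case_sum (\<lambda>s \<phi>. \<phi> $ fst (edge_arc s) + cis (\<alpha> (edge_arc s)) * \<phi> $ snd (edge_arc s))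
    (\<lambda>v \<phi>. \<phi> $ v :: complex)"
  define I where "I = Inl ` M \<union> Inr ` (- \<Union>M \<union> W)"
  \<comment> \<open>Reversing an arc multiplies its condition by a unit complex number, so either
    orientation may represent the edge.\<close>
  have sw: "\<phi> $ snd e + cis (\<alpha> (prod.swap e)) * \<phi> $ fst e = cis (- \<alpha> e) * (\<phi> $ fst e + cis (\<alpha> e) * \<phi> $ snd e)"
    if "e \<in> parcs G" for e \<phi>
    using that by (simp add: cis_swap distrib_left)
  have eqv: "l (Inl {fst e, snd e}) \<phi> = 0 \<longleftrightarrow> \<phi> $ fst e = - (cis (\<alpha> e) * \<phi> $ snd e)" if "e \<in> parcs G" for e \<phi>
    using edge_arc[OF that] sw[OF that, of \<phi>] by (auto simp: l_def eq_neg_iff_add_eq_0)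
  have "(\<forall>s\<in>M. l (Inl s) \<phi> = 0) \<longleftrightarrow> (\<forall>e\<in>matched_arcs. l (Inl {fst e, snd e}) \<phi> = 0)" for \<phi>
  proof (intro iffI ballI)
    fix s assume *: "\<forall>e\<in>matched_arcs. l (Inl {fst e, snd e}) \<phi> = 0" and s: "s \<in> M"
    obtain e where "e \<in> parcs G" "s = {fst e, snd e}" using uedges_cases[OF matching_subset[OF s]] .
    then show "l (Inl s) \<phi> = 0" using * s by (simp add: matched_arcs_def)
  qed (simp add: matched_arcs_def)
  then have arcs: "(\<forall>s\<in>M. l (Inl s) \<phi> = 0) \<longleftrightarrow>
      (\<forall>e\<in>matched_arcs. \<phi> $ fst e = - (cis (\<alpha> e) * \<phi> $ snd e))" for \<phi>
    using eqv matched_arc by simp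
  have "l (Inr v) \<phi> = \<phi> $ v" for v \<phi> by (simp add: l_def)
  then have Y: "Y W = {\<phi>. \<forall>i\<in>I. l i \<phi> = 0}"
    unfolding Y_def I_def alternating_def by (auto simp: ball_Un arcs)
  have "card I \<le> card (Inl ` M :: ('a set + 'a) set) + card (Inr ` (- \<Union>M \<union> W) :: ('a set + 'a) set)"
    unfolding I_def by (rule card_Un_le)
  also have "\<dots> \<le> card M + (card (- \<Union>M) + card W)"
    by (simp add: card_image card_Un_le)
  also have "card (- \<Union>M) = CARD('a) - 2 * card M"
    by (simp add: Compl_eq_Diff_UNIV card_Diff_subset card_matched_vertices)
  finally have "card I \<le> card M + (CARD('a) - 2 * card M + card W)" .
  moreover have "2 * card M \<le> CARD('a)"
    unfolding card_matched_vertices[symmetric] by (rule card_mono) auto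
  moreover have "vec.subspace (Y W) \<and> CARD('a) \<le> vec.dim (Y W) + card I"
    unfolding Y
  proof (rule dim_solution_space_ge)
    show "l i (\<phi> + \<eta>) = l i \<phi> + l i \<eta>" "l i (c *s \<phi>) = c * l i \<phi>" for i c \<phi> \<eta>
      by (cases i; simp add: l_def algebra_simps)+
  qed simp
  ultimately show ?thesis by linarith
qed

lemma matched_part_add: "matched_part (\<phi> + \<eta>) = matched_part \<phi> + matched_part \<eta>"
  unfolding boundary_add[symmetric]
  by (rule boundary_cong) (simp add: restrict_matching_def coboundary_add)

lemma matched_part_scale: "matched_part (c *s \<phi>) = c *s matched_part \<phi>"
  unfolding boundary_scale[symmetric]
  by (rule boundary_cong) (simp add: restrict_matching_def coboundary_scale)

text \<open>There is one condition per unmatched edge and one per element of \<open>W\<close>. By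
  covariance of the coboundary the two arcs of an edge give equivalent conditions.\<close>

lemma dim_perturbed_matching:
  defines "Z \<equiv> \<lambda>r W. {\<phi>. (\<forall>e\<in>parcs G - matched_arcs. coboundary \<phi> e + r * coboundary (matched_part \<phi>) e = 0)
    \<and> (\<forall>w\<in>W. matched_part \<phi> $ w = 0)}"
  shows "vec.subspace (Z r W) \<and>
    int CARD('a) + int (card M) - int (card (uedges G)) - int (card W) \<le> int (vec.dim (Z r W))"
proof -
  define t where "t = (\<lambda>e \<phi>. coboundary \<phi> e + r * coboundary (matched_part \<phi>) e)"
  define l where "l = case_sum (\<lambda>s \<phi>. t (edge_arc s) \<phi>) (\<lambda>w \<phi>. matched_part \<phi> $ w)"
  define I where "I = Inl ` (uedges G - M) \<union> Inr ` W"
  have sw: "t (prod.swap e) \<phi> = - (cis (- \<alpha> e) * t e \<phi>)" if "e \<in> parcs G" for e \<phi>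
    using covariant_coboundary that unfolding covariant_def t_def by (simp add: algebra_simps)
  have eqv: "t (edge_arc {fst e, snd e}) \<phi> = 0 \<longleftrightarrow> t e \<phi> = 0" if "e \<in> parcs G" for e \<phi>
    using edge_arc[OF that] sw[OF that, of \<phi>] by auto
  have arcs: "(\<forall>s\<in>uedges G - M. t (edge_arc s) \<phi> = 0) \<longleftrightarrow> (\<forall>e\<in>parcs G - matched_arcs. t e \<phi> = 0)" for \<phi>
  proof (intro iffI ballI)
    fix s assume *: "\<forall>e\<in>parcs G - matched_arcs. t e \<phi> = 0" and s: "s \<in> uedges G - M"
    obtain e where "e \<in> parcs G" "s = {fst e, snd e}" using uedges_cases[OF DiffD1[OF s]] .
    then show "t (edge_arc s) \<phi> = 0" using * s eqv by (simp add: matched_arcs_def)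
  next
    fix e assume *: "\<forall>s\<in>uedges G - M. t (edge_arc s) \<phi> = 0" and e: "e \<in> parcs G - matched_arcs"
    have "{fst e, snd e} \<in> uedges G"
      using e unfolding uedges_def by (auto intro!: image_eqI[of _ _ e] simp: case_prod_unfold)
    then have "{fst e, snd e} \<in> uedges G - M" using e by (simp add: matched_arcs_def)
    then show "t e \<phi> = 0" using * eqv e by blast
  qed
  have "Z r W = {\<phi>. (\<forall>e\<in>parcs G - matched_arcs. t e \<phi> = 0) \<and> (\<forall>w\<in>W. matched_part \<phi> $ w = 0)}"
    by (simp only: Z_def t_def)
  then have Z: "Z r W = {\<phi>. \<forall>i\<in>I. l i \<phi> = 0}"
    by (simp add: I_def ball_Un l_def arcs)
  have "card I \<le> card (Inl ` (uedges G - M) :: ('a set + 'a) set) + card (Inr ` W :: ('a set + 'a) set)"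
    unfolding I_def by (rule card_Un_le)
  also have "\<dots> = card (uedges G) - card M + card W"
    using matching by (simp add: card_image card_Diff_subset matching_def)
  finally have "card I \<le> card (uedges G) - card M + card W" .
  moreover have "vec.subspace (Z r W) \<and> CARD('a) \<le> vec.dim (Z r W) + card I"
    unfolding Z
  proof (rule dim_solution_space_ge)
    show "l i (\<phi> + \<eta>) = l i \<phi> + l i \<eta>" "l i (c *s \<phi>) = c * l i \<phi>" for i c \<phi> \<eta>
      by (cases i; simp add: l_def t_def matched_part_add matched_part_scale coboundary_add
          coboundary_scale algebra_simps)+
  qed simp
  ultimately show ?thesis using card_matching_le by linarith
qed

end

section \<open>Eigenvalue bounds from the two solution spaces\<close>

lemma (in magnetic_graph) self_adjoint_laplacian: "self_adjoint (magnetic_laplacian G \<alpha>)"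
proof
  show "magnetic_laplacian G \<alpha> (\<phi> + \<eta>) = magnetic_laplacian G \<alpha> \<phi> + magnetic_laplacian G \<alpha> \<eta>" for \<phi> \<eta>
    unfolding laplacian_eq boundary_add[symmetric] by (rule boundary_cong) (rule coboundary_add)
  show "magnetic_laplacian G \<alpha> (c *s \<phi>) = c *s magnetic_laplacian G \<alpha> \<phi>" for c \<phi>
    unfolding laplacian_eq boundary_scale[symmetric] by (rule boundary_cong) (rule coboundary_scale)
  show "inner (magnetic_laplacian G \<alpha> \<phi>) \<eta> = inner \<phi> (magnetic_laplacian G \<alpha> \<eta>)" for \<phi> \<eta>
    using inner_boundary[OF covariant_coboundary, of \<phi> \<eta>] inner_boundary[OF covariant_coboundary, of \<eta> \<phi>]
    by (simp add: laplacian_eq inner_commute)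
qed

text \<open>The set \<open>W\<close> lists vertices where vanishing is imposed, so that rigidity has
  a zero at \<open>u\<close> to start from: empty if \<open>u\<close> is unmatched,
  \<open>{u}\<close> for a perfect matching.\<close>

lemma (in magnetic_matching) eigenvalue_bounds:
  assumes u: "u \<in> W \<or> u \<notin> \<Union>M" and j: "1 \<le> j" "j \<le> int CARD('a)"
  shows "int CARD('a) - int (card M) + int (card W) < j \<Longrightarrow> 2 < eigval (magnetic_laplacian G \<alpha>) j"
    and "j \<le> int (card M) + int CARD('a) - int (card (uedges G)) - int (card W) \<Longrightarrow>
      eigval (magnetic_laplacian G \<alpha>) j < 2"
proof -
  note Y = dim_alternating[of W]
  note Z = dim_perturbed_matching[of "of_real (1 / CARD('a))" W]
  have zero: "g $ u = 0" if "alternating g" "\<forall>w\<in>W. g $ w = 0" for g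
    using that u by (auto simp: alternating_def)
  have alt: "alternating (matched_part \<phi>)" for \<phi>
    by (rule alternating_restricted_boundary[OF covariant_coboundary])
  show "2 < eigval (magnetic_laplacian G \<alpha>) j" if "int CARD('a) - int (card M) + int (card W) < j"
  proof (rule self_adjoint.less_eigval[OF self_adjoint_laplacian conjunct1[OF Y]])
    show "2 * inner \<phi> \<phi> < inner (magnetic_laplacian G \<alpha> \<phi>) \<phi>"
      if "\<phi> \<in> {\<phi>. alternating \<phi> \<and> (\<forall>w\<in>W. \<phi> $ w = 0)}" "\<phi> \<noteq> 0" for \<phi>
      using that by (intro laplacian_alternating_pos[of _ u] zero) auto
  qed (use j that Y in auto)
  show "eigval (magnetic_laplacian G \<alpha>) j < 2"
    if "j \<le> int (card M) + int CARD('a) - int (card (uedges G)) - int (card W)"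
  proof (rule self_adjoint.eigval_less[OF self_adjoint_laplacian _ conjunct1[OF Z]])
    show "inner (magnetic_laplacian G \<alpha> \<phi>) (magnetic_laplacian G \<alpha> \<phi>) < 2 * inner (magnetic_laplacian G \<alpha> \<phi>) \<phi>"
      if "\<phi> \<in> {\<phi>. (\<forall>e\<in>parcs G - matched_arcs.
          coboundary \<phi> e + of_real (1 / CARD('a)) * coboundary (matched_part \<phi>) e = 0) \<and>
          (\<forall>w\<in>W. matched_part \<phi> $ w = 0)}" "magnetic_laplacian G \<alpha> \<phi> \<noteq> 0" for \<phi>
      using that by (intro laplacian_square_less[of _ u] zero[OF alt]) auto
  qed (use j that Z in auto)
qed

lemma maximum_matching_exists:
  fixes G :: "'v::finite pair_pre_digraph"
  obtains M where "matching G M" "card M = matching_number G"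
proof -
  have "finite {card M |M. matching G M}"
    by (rule finite_subset[of _ "{..card (uedges G)}"]) (auto simp: matching_def intro: card_mono)
  moreover have "matching G {}" by (simp add: matching_def)
  then have "{card M |M. matching G M} \<noteq> {}" by blast
  ultimately have "matching_number G \<in> {card M |M. matching G M}"
    unfolding matching_number_def by (rule Max_in)
  then show ?thesis using that by auto
qed

theorem proposition3p8:
  fixes G :: "'v::finite pair_pre_digraph"
    and \<alpha> :: "'v \<times> 'v \<Rightarrow> real"
    and n m \<mu> :: int
  assumes "pair_graph G"
    and "pverts G = UNIV"
    and "Digraph_Component.connected (with_proj G)"
    and "magnetic_potential G \<alpha>"
    and "n = int (card (pverts G))"
    and "m = int (card (uedges G))"
    and "\<mu> = int (matching_number G)"
  shows "(n > 2 * \<mu> \<longrightarrow>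
      (1 \<le> \<mu> + n - m \<and> \<mu> + n - m \<le> n \<longrightarrow>
        eigval (magnetic_laplacian G \<alpha>) (\<mu> + n - m) < 2) \<and>
      (1 \<le> n - \<mu> + 1 \<and> n - \<mu> + 1 \<le> n \<longrightarrow>
        2 < eigval (magnetic_laplacian G \<alpha>) (n - \<mu> + 1))) \<and>
    (n = 2 * \<mu> \<longrightarrow>
      (1 \<le> 3 * n div 2 - m - 1 \<and> 3 * n div 2 - m - 1 \<le> n \<longrightarrow>
        eigval (magnetic_laplacian G \<alpha>) (3 * n div 2 - m - 1) < 2) \<and>
      (1 \<le> n div 2 + 2 \<and> n div 2 + 2 \<le> n \<longrightarrow>
        2 < eigval (magnetic_laplacian G \<alpha>) (n div 2 + 2)))"
proof -
  obtain M where M: "matching G M" "card M = matching_number G"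
    by (rule maximum_matching_exists)
  interpret magnetic_matching G \<alpha> M
    using assms M
    by (simp add: magnetic_matching_def magnetic_graph_def magnetic_matching_axioms_def)
  have n: "n = int CARD('v)" and \<mu>: "\<mu> = int (card M)"
    using assms M by simp_all
  show ?thesis
  proof (intro conjI impI)
    assume "n > 2 * \<mu>"
    \<comment> \<open>The matching covers \<open>2 * \<mu> < n\<close> vertices, so some vertex is
      unmatched and no extra condition is imposed.\<close>
    then have "\<Union>M \<noteq> UNIV"
      using card_matched_vertices n \<mu> by (metis less_irrefl of_nat_mult of_nat_numeral)
    then obtain u where u: "u \<in> {} \<or> u \<notin> \<Union>M" by blast
    show "eigval (magnetic_laplacian G \<alpha>) (\<mu> + n - m) < 2" if "1 \<le> \<mu> + n - m \<and> \<mu> + n - m \<le> n"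
      by (rule eigenvalue_bounds(2)[OF u]) (use that n \<mu> assms(6) in auto)
    show "2 < eigval (magnetic_laplacian G \<alpha>) (n - \<mu> + 1)" if "1 \<le> n - \<mu> + 1 \<and> n - \<mu> + 1 \<le> n"
      by (rule eigenvalue_bounds(1)[OF u]) (use that n \<mu> in auto)
  next
    assume half: "n = 2 * \<mu>"
    \<comment> \<open>Vanishing is imposed at an arbitrary vertex. This one condition shifts each
      index by one; as \<open>n\<close> is even, \<open>3 * n div 2\<close> equals
      \<open>\<mu> + n\<close>, and \<open>n div 2\<close> equals \<open>n - \<mu>\<close>.\<close>
    have u: "u \<in> {u} \<or> u \<notin> \<Union>M" for u by simp
    show "eigval (magnetic_laplacian G \<alpha>) (3 * n div 2 - m - 1) < 2"
      if "1 \<le> 3 * n div 2 - m - 1 \<and> 3 * n div 2 - m - 1 \<le> n"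
      by (rule eigenvalue_bounds(2)[OF u]) (use that n \<mu> half assms(6) in auto)
    show "2 < eigval (magnetic_laplacian G \<alpha>) (n div 2 + 2)" if "1 \<le> n div 2 + 2 \<and> n div 2 + 2 \<le> n"
      by (rule eigenvalue_bounds(1)[OF u]) (use that n \<mu> half in auto)
  qed
qed

end
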